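(* Let $(\eta,\gamma)$ be a pair of real random variables with finite positive variances $\sigma_\eta^2,\sigma_\gamma^2$, means $\mu_\eta,\mu_\gamma$, and correlation $\rho\in(-1,1)$, and let $m>0$. For a policy $(\beta,\beta_0)\in\mathbb{R}^2$ let the welfare loss be $\mathbb{E}[(\beta(\eta+m\beta\gamma)+\beta_0-\eta)^2]$. Then there is a unique policy $(\beta^*,\beta_0^* )\in\mathbb{R}^2$ minimizing the welfare loss. It satisfies $\beta^*>0$, and $\beta^*<\beta^{\mathrm{fp}}$ for every fixed point $(\beta^{\mathrm{fp}},\beta_0^{\mathrm{fp}})$ with $\beta^{\mathrm{fp}}>0$. Moreover, $\hat\beta(\beta^* )>\beta^*$.
   Context: A designer uses a linear policy $(\beta,\beta_0)$, giving allocation $Y(x)=\beta x+\beta_0$ to an agent with observed action $x$. An agent of type $(\eta,\gamma)$ responds with action $x=X_\beta(\eta,\gamma)=\eta+m\beta\gamma$. For each $\beta\in\mathbb{R}$, $\hat\beta(\beta)$ and $\hat\beta_0(\beta)$ denote the coefficients of the ordinary least squares (best linear) predictor of $\eta$ from $x=\eta+m\beta\gamma$: $$\hat\beta(\beta)=\frac{\mathrm{Cov}(x,\eta)}{\mathrm{Var}(x)}=\frac{\sigma_\eta^2+m\rho\sigma_\eta\sigma_\gamma\beta}{\sigma_\eta^2+m^2\sigma_\gamma^2\beta^2+2m\rho\sigma_\eta\sigma_\gamma\beta},\qquad \hat\beta_0(\beta)=\mu_\eta-\hat\beta(\beta)\,[\mu_\eta+m\beta\mu_\gamma].$$ (The denominator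 is positive because $|\rho|<1$.) A policy $(\beta^{\mathrm{fp}},\beta_0^{\mathrm{fp}})$ is a fixed point if $\beta^{\mathrm{fp}}=\hat\beta(\beta^{\mathrm{fp}})$ and $\beta_0^{\mathrm{fp}}=\hat\beta_0(\beta^{\mathrm{fp}})$. *)

theory Defs
  imports "HOL-Probability.Probability"
begin

definition covariance :: "'a measure \<Rightarrow> ('a \<Rightarrow> real) \<Rightarrow> ('a \<Rightarrow> real) \<Rightarrow> real" where
  "covariance M X Y =
     prob_space.expectation M
       (\<lambda>\<omega>. (X \<omega> - prob_space.expectation M X) * (Y \<omega> - prob_space.expectation M Y))"

definition correlation :: "'a measure \<Rightarrow> ('a \<Rightarrow> real) \<Rightarrow> ('a \<Rightarrow> real) \<Rightarrow> real" where
  "correlation M X Y =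
     covariance M X Y / (sqrt (prob_space.variance M X) * sqrt (prob_space.variance M Y))"

(* A policy is a pair (slope, intercept). *)
definition allocation :: "real \<times> real \<Rightarrow> real \<Rightarrow> real" where
  "allocation p x = fst p * x + snd p"

(* The best response of type (e, g) depends on the policy only through its slope b. *)
definition response :: "real \<Rightarrow> real \<Rightarrow> real \<Rightarrow> real \<Rightarrow> real" where
  "response m b e g = e + m * b * g"

definition welfare_loss ::
    "'a measure \<Rightarrow> ('a \<Rightarrow> real) \<Rightarrow> ('a \<Rightarrow> real) \<Rightarrow> real \<Rightarrow> real \<times> real \<Rightarrow> real" where
  "welfare_loss M \<eta> \<gamma> m p =
     prob_space.expectation M
       (\<lambda>\<omega>. (allocation p (response m (fst p) (\<eta> \<omega>) (\<gamma> \<omega>)) - \<eta> \<omega>)\<^sup>2)"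

definition optimal_policy ::
    "'a measure \<Rightarrow> ('a \<Rightarrow> real) \<Rightarrow> ('a \<Rightarrow> real) \<Rightarrow> real \<Rightarrow> real \<times> real \<Rightarrow> bool" where
  "optimal_policy M \<eta> \<gamma> m p \<longleftrightarrow> is_arg_min (welfare_loss M \<eta> \<gamma> m) (\<lambda>_. True) p"

(* Slope and intercept of the ordinary least squares predictor of \<eta> from the observed
   action when agents respond to a policy of slope b. *)
definition beta_hat ::
    "'a measure \<Rightarrow> ('a \<Rightarrow> real) \<Rightarrow> ('a \<Rightarrow> real) \<Rightarrow> real \<Rightarrow> real \<Rightarrow> real" where
  "beta_hat M \<eta> \<gamma> m b =
     (let x = (\<lambda>\<omega>. response m b (\<eta> \<omega>) (\<gamma> \<omega>))
      in covariance M x \<eta> / prob_space.variance M x)"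

definition beta0_hat ::
    "'a measure \<Rightarrow> ('a \<Rightarrow> real) \<Rightarrow> ('a \<Rightarrow> real) \<Rightarrow> real \<Rightarrow> real \<Rightarrow> real" where
  "beta0_hat M \<eta> \<gamma> m b =
     prob_space.expectation M \<eta>
       - beta_hat M \<eta> \<gamma> m b * (prob_space.expectation M \<eta> + m * b * prob_space.expectation M \<gamma>)"

definition fixed_point_policy ::
    "'a measure \<Rightarrow> ('a \<Rightarrow> real) \<Rightarrow> ('a \<Rightarrow> real) \<Rightarrow> real \<Rightarrow> real \<times> real \<Rightarrow> bool" where
  "fixed_point_policy M \<eta> \<gamma> m p \<longleftrightarrow>
     fst p = beta_hat M \<eta> \<gamma> m (fst p) \<and> snd p = beta0_hat M \<eta> \<gamma> m (fst p)"

end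

theory Submission
  imports Defs
begin

text \<open>
  Minimising over the intercept reduces the welfare loss to the quartic
  \<open>L b = Var ((b - 1) \<eta> + m b\<^sup>2 \<gamma>)\<close>. The reflection \<open>b \<mapsto> b / (b - 1)\<close> divides \<open>L\<close> by \<open>(b - 1)\<^sup>4\<close>,
  which confines minimisers to \<open>[0, 2]\<close>. Two distinct minimisers would make \<open>L\<close> minus its minimum
  a multiple of a squared quadratic, and comparing coefficients contradicts \<open>\<bar>\<rho>\<bar> < 1\<close>.
  At a minimiser the first-order condition gives
  \<open>L b = (2 - b) * (a + k b - b Var x)\<close>, with \<open>a = Var \<eta>\<close> and \<open>k = m Cov (\<eta>, \<gamma>)\<close>, so that the best
  linear predictor has slope above \<open>b\<close>. Finally, \<open>(a + k b - b Var x) / b\<close> is strictly decreasing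
  on \<open>(0, 2)\<close>, so it has no zero below the minimiser.
\<close>

lemma quadratic_form_pos:
  fixes a k c x y :: real
  assumes "0 < a" "k\<^sup>2 < a * c" "x \<noteq> 0 \<or> y \<noteq> 0"
  shows "0 < a * x\<^sup>2 + 2 * k * x * y + c * y\<^sup>2"
proof -
  have eq: "a * (a * x\<^sup>2 + 2 * k * x * y + c * y\<^sup>2) = (a * x + k * y)\<^sup>2 + (a * c - k\<^sup>2) * y\<^sup>2"
    by algebra
  have "0 < (a * x + k * y)\<^sup>2 + (a * c - k\<^sup>2) * y\<^sup>2"
  proof (cases "y = 0")
    case False
    then show ?thesis using assms by (intro add_nonneg_pos) auto
  qed (use assms in auto)
  with eq assms(1) show ?thesis by (metis zero_less_mult_pos)
qed

text \<open>In the application \<open>a = Var \<eta>\<close>, \<open>k = Cov (\<eta>, m \<gamma>)\<close> and \<open>c = Var (m \<gamma>)\<close>.\<close>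

locale loss_quartic =
  fixes a k c :: real
  assumes a_pos: "0 < a" and c_pos: "0 < c" and det_pos: "k\<^sup>2 < a * c"
begin

definition L :: "real \<Rightarrow> real" where
  "L b = a * (b - 1)\<^sup>2 + 2 * k * (b - 1) * b\<^sup>2 + c * (b\<^sup>2)\<^sup>2"

definition V :: "real \<Rightarrow> real" where
  "V b = a + 2 * k * b + c * b\<^sup>2"

text \<open>In the application this is \<open>V b\<close> times the gap between the least squares
  slope and \<open>b\<close>: its sign compares the two, and fixed-point slopes are its
  zeros.\<close>

definition excess :: "real \<Rightarrow> real" where
  "excess b = a + k * b - b * V b"

lemma L_pos: "0 < L b"
  unfolding L_def using quadratic_form_pos[OF a_pos det_pos, of "b - 1" "b\<^sup>2"] by auto

lemma V_pos: "0 < V b"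
  unfolding V_def using quadratic_form_pos[OF a_pos det_pos, of 1 b] by simp

text \<open>With r = b / (b - 1) one has r - 1 = 1 / (b - 1), so the pair (r - 1, r^2) is (b - 1,
  b^2) divided by (b - 1)^2, and \<open>L\<close> is a quadratic form in that pair.\<close>

lemma reflect_L: "b \<noteq> 1 \<Longrightarrow> L (b / (b - 1)) * (b - 1) ^ 4 = L b"
proof -
  assume b: "b \<noteq> 1"
  define r where "r = b / (b - 1)"
  have r: "r * (b - 1) = b" "(r - 1) * (b - 1) = 1"
    using b by (auto simp: r_def field_simps)
  have "L r * (b - 1) ^ 4 =
      a * (((r - 1) * (b - 1)) * (b - 1))\<^sup>2
      + 2 * k * ((r - 1) * (b - 1)) * (b - 1) * (r * (b - 1))\<^sup>2 + c * ((r * (b - 1))\<^sup>2)\<^sup>2"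
    unfolding L_def by algebra
  also have "\<dots> = L b" unfolding r L_def by simp
  finally show ?thesis by (simp add: r_def)
qed

lemma reflect_better:
  assumes "b \<notin> {0..2}"
  shows "b / (b - 1) \<in> {0..2}" "L (b / (b - 1)) < L b"
proof -
  show "b / (b - 1) \<in> {0..2}"
    using assms by (cases "b < 0") (auto simp: field_simps)
  have "1 < \<bar>b - 1\<bar>" using assms by auto
  then have "1 < \<bar>b - 1\<bar> ^ 4" by (rule one_less_power) simp
  then have "1 < (b - 1) ^ 4" by simp
  then have "L (b / (b - 1)) * 1 < L (b / (b - 1)) * (b - 1) ^ 4"
    using L_pos by (intro mult_strict_left_mono)
  then show "L (b / (b - 1)) < L b"
    using reflect_L[of b] assms by fastforce
qed

lemma L_has_minimum: "\<exists>b. \<forall>x. L b \<le> L x"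
proof -
  have "continuous_on {0..2} L" unfolding L_def by (intro continuous_intros)
  then have "\<exists>b\<in>{0..2}. \<forall>x\<in>{0..2}. L b \<le> L x"
    by (intro continuous_attains_inf) auto
  then obtain b where b: "\<And>x. x \<in> {0..2} \<Longrightarrow> L b \<le> L x" by blast
  \<comment> \<open>A point outside the compact interval is beaten by its reflection, which lies
    inside, so the minimum over the interval is global.\<close>
  have "L b \<le> L x" for x
    using b[of x] b[of "x / (x - 1)"] reflect_better[of x] by fastforce
  then show ?thesis by blast
qed

lemma first_order_condition:
  assumes "\<And>x. L b \<le> L x"
  shows "a * (b - 1) + k * (3 * b\<^sup>2 - 2 * b) + 2 * c * b ^ 3 = 0"
proof -
  have "(L has_real_derivative
      2 * (a * (b - 1) + k * (3 * b\<^sup>2 - 2 * b) + 2 * c * b ^ 3)) (at b)"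
    unfolding L_def
    by (auto intro!: derivative_eq_intros simp: algebra_simps power2_eq_square power3_eq_cube)
  then have "2 * (a * (b - 1) + k * (3 * b\<^sup>2 - 2 * b) + 2 * c * b ^ 3) = 0"
    using assms by (intro DERIV_local_min[where d = 1]) auto
  then show ?thesis by simp
qed

lemma minimum_unique:
  assumes x: "\<And>z. L x \<le> L z" and y: "\<And>z. L y \<le> L z"
  shows "x = y"
proof (rule ccontr)
  assume "x \<noteq> y"
  \<comment> \<open>The two minimisers are the roots of t^2 - s t + p; every relation below is
    symmetric in them.\<close>
  define s p where "s = x + y" and "p = x * y"
  have disc: "0 < s\<^sup>2 - 4 * p"
  proof -
    have "s\<^sup>2 - 4 * p = (x - y)\<^sup>2" unfolding s_def p_def by algebra
    then show ?thesis using \<open>x \<noteq> y\<close> by simp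
  qed
  note fx = first_order_condition[OF x] and fy = first_order_condition[OF y]
  \<comment> \<open>Difference of the two first-order conditions, with the factor x - y split
    off.\<close>
  have "(x - y) * (a + k * (3 * s - 2) + 2 * c * (s\<^sup>2 - p)) = 0"
    using fx fy unfolding s_def p_def by algebra
  then have slope: "a + k * (3 * s - 2) + 2 * c * (s\<^sup>2 - p) = 0"
    using \<open>x \<noteq> y\<close> by simp
  have "L x = L y" using x y by (meson order_antisym)
  then have "(x - y) * (c * s * (s\<^sup>2 - 2 * p) + 2 * k * (s\<^sup>2 - p) + (a - 2 * k) * s - 2 * a) = 0"
    unfolding s_def p_def L_def by algebra
  then have chord: "c * s * (s\<^sup>2 - 2 * p) + 2 * k * (s\<^sup>2 - p) + (a - 2 * k) * s - 2 * a = 0"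
    using \<open>x \<noteq> y\<close> by simp
  \<comment> \<open>Sum of the two first-order conditions. Subtracting \<open>chord\<close> leaves
    the discriminant as a factor, so k = -c s, which is what matching the cubic coefficient of
    \<open>L\<close> with c (t^2 - s t + p)^2 gives.\<close>
  have "a * (s - 2) + k * (3 * (s\<^sup>2 - 2 * p) - 2 * s) + 2 * c * (s ^ 3 - 3 * s * p) = 0"
    using fx fy unfolding s_def p_def by algebra
  with chord have "(s\<^sup>2 - 4 * p) * (k + c * s) = 0" by algebra
  with disc have k: "k = - c * s" by simp
  have "(s - 2) * (a - c * s\<^sup>2) = 0" using chord unfolding k by algebra
  then consider "s = 2" | "a = c * s\<^sup>2" by auto
  then show False
  proof cases
    case 1
    \<comment> \<open>Here k = -2 c, so the determinant condition forces p > 2, while distinct roots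
      with sum 2 need p < 1.\<close>
    then have "a = 2 * c * p" using slope unfolding k by (simp add: algebra_simps)
    then have "(c * c) * 2 < (c * c) * p"
      using det_pos unfolding k 1 by (simp add: power2_eq_square algebra_simps)
    then have "2 < p" using c_pos by simp
    with disc 1 show False by simp
  next
    case 2
    \<comment> \<open>Now k^2 = a c, the excluded case of perfect correlation.\<close>
    then show False using det_pos unfolding k by (simp add: power2_eq_square)
  qed
qed

lemma minimum_excess:
  assumes min: "\<And>x. L b \<le> L x"
  shows "0 < b" "b < 2" "0 < excess b"
proof -
  have "b \<in> {0..2}" using reflect_better(2)[of b] min by (meson not_le)
  then have b: "0 \<le> b" "b \<le> 2" by auto
  \<comment> \<open>For every b, \<open>L b - (2 - b) * excess b\<close> equals half the derivative
    of \<open>L\<close>, which vanishes at a minimiser.\<close>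
  have "L b = (2 - b) * excess b"
    using first_order_condition[OF min] unfolding L_def excess_def V_def by algebra
  then have pos: "0 < (2 - b) * excess b" using L_pos[of b] by simp
  then show "b < 2" using b by (cases "b = 2") auto
  with pos show "0 < excess b" by (simp add: zero_less_mult_iff)
  \<comment> \<open>At 0 the first-order condition would read -a = 0.\<close>
  have "b \<noteq> 0" using first_order_condition[OF min] a_pos by auto
  with b show "0 < b" by simp
qed

lemma excess_zero_above:
  assumes min: "\<And>x. L b \<le> L x" and f: "0 < f" "excess f = 0"
  shows "b < f"
proof (rule ccontr)
  assume "\<not> b < f"
  then have "f \<le> b" by simp
  note b = minimum_excess[OF min]
  \<comment> \<open>This lets the term with f + b below be bounded from below by
    \<open>c * (f * b)\<^sup>2\<close>, so that the whole factor exceeds a value of the positive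
    form \<open>V\<close>, taken at f b.\<close>
  have "f * b < f + b"
  proof -
    have "f * b < f * 2" using f b by simp
    then show ?thesis using \<open>f \<le> b\<close> by simp
  qed
  then have "c * (f * b) * (f * b) \<le> c * (f * b) * (f + b)"
    using c_pos f b by (intro mult_left_mono) auto
  moreover have "0 < a + 2 * k * (f * b) + c * (f * b)\<^sup>2"
    using quadratic_form_pos[OF a_pos det_pos, of 1 "f * b"] by simp
  ultimately have "0 < a + 2 * k * (f * b) + c * (f * b) * (f + b)"
    by (simp add: power2_eq_square algebra_simps)
  then have "0 \<le> (b - f) * (a + 2 * k * (f * b) + c * (f * b) * (f + b))"
    using \<open>f \<le> b\<close> by simp
  \<comment> \<open>Up to the factor f b this is the difference of \<open>excess t / t\<close> at f
    and b, so the sign of the factor expresses monotonicity of that quotient.\<close>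
  also have "\<dots> = excess f * b - excess b * f"
    unfolding excess_def V_def by algebra
  also have "\<dots> < 0" using f b by simp
  finally show False by simp
qed

end

text \<open>The mixed product of two affine forms covers the welfare loss, the variance of the
  action and its covariance with \<eta> by one computation.\<close>

lemma (in prob_space) expectation_mult_affine:
  fixes X Y :: "'a \<Rightarrow> real"
  assumes [measurable]: "X \<in> borel_measurable M" "Y \<in> borel_measurable M"
    and X2: "integrable M (\<lambda>\<omega>. (X \<omega>)\<^sup>2)" and Y2: "integrable M (\<lambda>\<omega>. (Y \<omega>)\<^sup>2)"
  shows "expectation (\<lambda>\<omega>. (p * X \<omega> + q * Y \<omega> + r) * (p' * X \<omega> + q' * Y \<omega> + r')) =
    p * p' * variance X + (p * q' + p' * q) * covariance M X Y + q * q' * variance Y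
    + (p * expectation X + q * expectation Y + r) * (p' * expectation X + q' * expectation Y + r')"
proof -
  have X: "integrable M X" and Y: "integrable M Y"
    using X2 Y2 by (auto intro: square_integrable_imp_integrable)
  have XY: "integrable M (\<lambda>\<omega>. X \<omega> * Y \<omega>)"
  proof (rule Bochner_Integration.integrable_bound)
    show "integrable M (\<lambda>\<omega>. (X \<omega>)\<^sup>2 + (Y \<omega>)\<^sup>2)" using X2 Y2 by simp
    have "\<bar>x * y\<bar> \<le> x\<^sup>2 + y\<^sup>2" for x y :: real
      using sum_squares_bound[of "\<bar>x\<bar>" "\<bar>y\<bar>"] abs_ge_zero[of "x * y"]
      unfolding abs_mult power2_abs by linarith
    then show "AE \<omega> in M. norm (X \<omega> * Y \<omega>) \<le> norm ((X \<omega>)\<^sup>2 + (Y \<omega>)\<^sup>2)"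
      by simp
  qed simp
  have "covariance M X Y = expectation (\<lambda>\<omega>. X \<omega> * Y \<omega> - expectation Y * X \<omega>
      - expectation X * Y \<omega> + expectation X * expectation Y)"
    unfolding covariance_def by (intro Bochner_Integration.integral_cong) (auto simp: algebra_simps)
  also have "\<dots> = expectation (\<lambda>\<omega>. X \<omega> * Y \<omega>) - expectation X * expectation Y"
    using X Y XY by (simp add: prob_space)
  finally have cov: "expectation (\<lambda>\<omega>. X \<omega> * Y \<omega>) = covariance M X Y + expectation X * expectation Y"
    by simp
  have sq: "expectation (\<lambda>\<omega>. (X \<omega>)\<^sup>2) = variance X + (expectation X)\<^sup>2"
    "expectation (\<lambda>\<omega>. (Y \<omega>)\<^sup>2) = variance Y + (expectation Y)\<^sup>2"
    using variance_eq[OF X X2] variance_eq[OF Y Y2] by auto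
  have "expectation (\<lambda>\<omega>. (p * X \<omega> + q * Y \<omega> + r) * (p' * X \<omega> + q' * Y \<omega> + r')) =
      expectation (\<lambda>\<omega>. p * p' * (X \<omega>)\<^sup>2 + (p * q' + p' * q) * (X \<omega> * Y \<omega>) + q * q' * (Y \<omega>)\<^sup>2
        + (p * r' + p' * r) * X \<omega> + (q * r' + q' * r) * Y \<omega> + r * r')"
    by (intro Bochner_Integration.integral_cong) (auto simp: algebra_simps power2_eq_square)
  also have "\<dots> = p * p' * expectation (\<lambda>\<omega>. (X \<omega>)\<^sup>2)
      + (p * q' + p' * q) * expectation (\<lambda>\<omega>. X \<omega> * Y \<omega>) + q * q' * expectation (\<lambda>\<omega>. (Y \<omega>)\<^sup>2)
      + (p * r' + p' * r) * expectation X + (q * r' + q' * r) * expectation Y + r * r'"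
    using X Y XY X2 Y2 by (simp add: prob_space)
  also have "\<dots> = p * p' * variance X + (p * q' + p' * q) * covariance M X Y + q * q' * variance Y
    + (p * expectation X + q * expectation Y + r) * (p' * expectation X + q' * expectation Y + r')"
    unfolding cov sq by algebra
  finally show ?thesis .
qed

theorem proposition2:
  fixes M :: "'a measure" and \<eta> \<gamma> :: "'a \<Rightarrow> real" and m :: real
  assumes "prob_space M"
    and "\<eta> \<in> borel_measurable M" and "\<gamma> \<in> borel_measurable M"
    and "integrable M (\<lambda>\<omega>. (\<eta> \<omega>)\<^sup>2)" and "integrable M (\<lambda>\<omega>. (\<gamma> \<omega>)\<^sup>2)"
    and "prob_space.variance M \<eta> > 0" and "prob_space.variance M \<gamma> > 0"
    and "-1 < correlation M \<eta> \<gamma>" and "correlation M \<eta> \<gamma> < 1"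
    and "m > 0"
  shows "(\<exists>!p. optimal_policy M \<eta> \<gamma> m p) \<and>
    (\<forall>\<beta>s \<beta>0s. optimal_policy M \<eta> \<gamma> m (\<beta>s, \<beta>0s) \<longrightarrow>
       \<beta>s > 0 \<and>
       (\<forall>\<beta>fp \<beta>0fp. fixed_point_policy M \<eta> \<gamma> m (\<beta>fp, \<beta>0fp) \<and> \<beta>fp > 0 \<longrightarrow> \<beta>s < \<beta>fp) \<and>
       beta_hat M \<eta> \<gamma> m \<beta>s > \<beta>s)"
proof -
  interpret prob_space M by fact
  define C where "C = covariance M \<eta> \<gamma>"
  define a k c where "a = variance \<eta>" and "k = m * C" and "c = m\<^sup>2 * variance \<gamma>"
  note mult_affine = expectation_mult_affine[OF assms(2-5)]

  have C_bound: "C\<^sup>2 < variance \<eta> * variance \<gamma>"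
  proof -
    have sd: "0 < sqrt (variance \<eta>) * sqrt (variance \<gamma>)" using assms(6,7) by simp
    then have "\<bar>C\<bar> < sqrt (variance \<eta>) * sqrt (variance \<gamma>)"
      using assms(8,9) unfolding correlation_def C_def[symmetric] by (simp add: field_simps abs_less_iff)
    then have "\<bar>C\<bar>\<^sup>2 < (sqrt (variance \<eta>) * sqrt (variance \<gamma>))\<^sup>2"
      by (intro power_strict_mono) auto
    then show ?thesis using assms(6,7) by (simp add: power_mult_distrib)
  qed
  interpret loss_quartic a k c
  proof
    show "0 < a" "0 < c" using assms by (auto simp: a_def c_def)
    show "k\<^sup>2 < a * c"
      using C_bound \<open>m > 0\<close> by (simp add: a_def k_def c_def power_mult_distrib mult.left_commute)
  qed

  \<comment> \<open>The intercept that makes the mean allocation error zero; the loss is then error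
    variance plus squared mean error.\<close>
  define opt0 where "opt0 b = - ((b - 1) * expectation \<eta> + m * b\<^sup>2 * expectation \<gamma>)" for b
  have loss: "welfare_loss M \<eta> \<gamma> m (b, b0) = L b + (b0 - opt0 b)\<^sup>2" for b b0
  proof -
    have "welfare_loss M \<eta> \<gamma> m (b, b0) = expectation (\<lambda>\<omega>.
        ((b - 1) * \<eta> \<omega> + m * b\<^sup>2 * \<gamma> \<omega> + b0) * ((b - 1) * \<eta> \<omega> + m * b\<^sup>2 * \<gamma> \<omega> + b0))"
      unfolding welfare_loss_def allocation_def response_def
      by (intro Bochner_Integration.integral_cong) (auto simp: algebra_simps power2_eq_square)
    also have "\<dots> = L b + (b0 - opt0 b)\<^sup>2"
      unfolding mult_affine C_def[symmetric] L_def opt0_def unfolding a_def k_def c_def by algebra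
    finally show ?thesis .
  qed
  have optimal_iff: "optimal_policy M \<eta> \<gamma> m (b, b0) \<longleftrightarrow> (\<forall>x. L b \<le> L x) \<and> b0 = opt0 b" for b b0
  proof
    assume "optimal_policy M \<eta> \<gamma> m (b, b0)"
    \<comment> \<open>Comparing only with policies of optimal intercept suffices: x = b forces the
      square to vanish, and general x gives minimality of the slope.\<close>
    then have "welfare_loss M \<eta> \<gamma> m (b, b0) \<le> welfare_loss M \<eta> \<gamma> m (x, opt0 x)" for x
      by (simp add: optimal_policy_def is_arg_min_linorder)
    then have le: "L b + (b0 - opt0 b)\<^sup>2 \<le> L x" for x by (simp add: loss)
    have "L b \<le> L x" for x
      using le[of x] zero_le_power2[of "b0 - opt0 b"] by linarith
    moreover have "b0 = opt0 b" using le[of b] by simp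
    ultimately show "(\<forall>x. L b \<le> L x) \<and> b0 = opt0 b" by blast
  next
    assume "(\<forall>x. L b \<le> L x) \<and> b0 = opt0 b"
    then show "optimal_policy M \<eta> \<gamma> m (b, b0)"
      by (auto simp: optimal_policy_def is_arg_min_linorder loss intro: add_increasing2)
  qed

  have beta_hat: "beta_hat M \<eta> \<gamma> m b = (a + k * b) / V b" for b
  proof -
    let ?x = "\<lambda>\<omega>. response m b (\<eta> \<omega>) (\<gamma> \<omega>)"
    have mean: "expectation ?x = expectation \<eta> + m * b * expectation \<gamma>"
      unfolding response_def using assms(2-5)
      by (simp add: square_integrable_imp_integrable)
    \<comment> \<open>Subtracting the mean as the constant term makes the product of means in
      \<open>mult_affine\<close> vanish.\<close>
    have "variance ?x = expectation (\<lambda>\<omega>. (1 * \<eta> \<omega> + (m * b) * \<gamma> \<omega> + - expectation ?x)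
        * (1 * \<eta> \<omega> + (m * b) * \<gamma> \<omega> + - expectation ?x))"
      unfolding mean by (intro Bochner_Integration.integral_cong)
        (auto simp: response_def power2_eq_square algebra_simps)
    also have "\<dots> = V b"
      unfolding mult_affine mean C_def[symmetric] V_def unfolding a_def k_def c_def by algebra
    finally have var: "variance ?x = V b" .
    have "covariance M ?x \<eta> = expectation (\<lambda>\<omega>. (1 * \<eta> \<omega> + (m * b) * \<gamma> \<omega> + - expectation ?x)
        * (1 * \<eta> \<omega> + 0 * \<gamma> \<omega> + - expectation \<eta>))"
      unfolding covariance_def mean by (intro Bochner_Integration.integral_cong)
        (auto simp: response_def algebra_simps)
    also have "\<dots> = a + k * b"
      unfolding mult_affine mean C_def[symmetric] a_def k_def by algebra
    finally show ?thesis unfolding beta_hat_def Let_def var by simp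
  qed
  have predictor_above: "b < beta_hat M \<eta> \<gamma> m b \<longleftrightarrow> 0 < excess b" for b
    using V_pos[of b] by (simp add: beta_hat excess_def pos_less_divide_eq)
  have fixed_excess: "excess f = 0" if "fixed_point_policy M \<eta> \<gamma> m (f, f0)" for f f0
  proof -
    have "f = (a + k * f) / V f"
      using that by (simp add: fixed_point_policy_def beta_hat)
    then show ?thesis using V_pos[of f] by (simp add: excess_def field_simps)
  qed

  have "\<exists>!p. optimal_policy M \<eta> \<gamma> m p"
  proof -
    obtain b where b: "\<forall>x. L b \<le> L x" using L_has_minimum by blast
    show ?thesis
    proof (rule ex1I[of _ "(b, opt0 b)"])
      show "optimal_policy M \<eta> \<gamma> m (b, opt0 b)" using b by (simp add: optimal_iff)
    next
      fix p assume "optimal_policy M \<eta> \<gamma> m p"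
      then have p: "\<forall>x. L (fst p) \<le> L x" "snd p = opt0 (fst p)"
        using optimal_iff[of "fst p" "snd p"] by auto
      then have "fst p = b" using b minimum_unique[of "fst p" b] by blast
      with p show "p = (b, opt0 b)" by (simp add: prod_eq_iff)
    qed
  qed
  moreover have "0 < b \<and> (\<forall>f f0. fixed_point_policy M \<eta> \<gamma> m (f, f0) \<and> 0 < f \<longrightarrow> b < f)
      \<and> b < beta_hat M \<eta> \<gamma> m b" if "optimal_policy M \<eta> \<gamma> m (b, b0)" for b b0
  proof -
    have min: "\<And>x. L b \<le> L x" using that by (simp add: optimal_iff)
    then show ?thesis
      using minimum_excess[OF min] excess_zero_above[OF min] fixed_excess
      unfolding predictor_above by blast
  qed
  ultimately show ?thesis by blast
qed

end
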